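(* There is a suitable constant $b>1/m$ (for example $b=1.85$) such that for ANF instances on arbitrary directed graphs with $m\ge9$ edges in which every commodity can be routed by itself, and for any $\epsilon$ with $1/m\le\epsilon<1$, the randomized rounding algorithm described in the context, when run on an optimum solution of the compact edge-flow LP, achieves with high probability a $\bigl(1-\epsilon,\;3b\ln m/\ln\ln m\bigr)$-approximation for the ANF problem.
   Context: ANF problem: given a directed graph $G=(V,E)$, $m=|E|$, with capacities $c(e)>0$, and $k$ commodities $(s_i,t_i)$, $s_i\neq t_i$, with demands $d_i>0$ and weights $w_i>0$, $i\in[k]=\{1,\dots,k\}$, choose a set $K'\subseteq[k]$ and for each $i\in K'$ a (fractional, splittable) flow of $d_i$ units from $s_i$ to $t_i$ such that the load (total flow of all chosen commodities) of every edge $e$ is at most $c(e)$; maximize the throughput $\sum_{i\in K'}w_i$. Standing assumption: every commodity can be routed by itself in $G$ within the capacities (others are discarded). An $(\alpha,\beta)$-approximation is a set of commodities with flows fully routing them, whose throughput is at least $\alpha$ times the maximum throughput (under the original capacities) and whose load on every edge $e$ is at most $\beta c(e)$. Compact edge-flow LP: maximize $\sum_iw_if_i$ subject to: the net outflow at $s_i$ of $(f_{i,e})_e$ equals $f_i$ and flow conservation of $(f_{i,e})_e$ holds at all $v\ne s_i,t_i$, for each $i$; $\sum_i d_if_{i,e}\le c(e)$ for all $e$; $d_if_{i,e}\le f_i\,c(e)$ for all $i,e$; $f_{i,e}\ge0$; $f_i\in[0,1]$. Randomized rounding algorithm: let $(\tilde f_i,\tilde f_{i,e})$ be the given solution of the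 compact LP. (Round) Independently for each $i$, set $f_i=1$ with probability $\tilde f_i$ and $f_i=0$ otherwise. (Rescale) Set $f_{i,e}=\frac{\tilde f_{i,e}}{\tilde f_i}f_i$ (and $f_{i,e}=0$ if $f_i=0$); the flow of commodity $i$ on $e$ is $f_{i,e}d_i$. If $\sum_iw_if_i\ge(1-\epsilon)\sum_iw_i\tilde f_i$ and $\sum_if_{i,e}d_i\le(3b\ln m/\ln\ln m)\,c(e)$ for all $e\in E$, return this solution. Otherwise repeat Round and Rescale with fresh randomness, up to $\Theta((\ln m)/\epsilon^2)$ times (with a suitable constant). "With high probability" means with probability at least $1-m^{-c'}$ for a constant $c'>0$. *)

theory Defs
  imports "HOL-Probability.Probability" "Graph_Theory.Digraph"
begin

section \<open>The ANF problem\<close>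

text \<open>Commodities are indexed by \<open>{1..ncom I}\<close>; commodity \<open>i\<close> has source \<open>src I i\<close>, target
  \<open>tgt I i\<close>, demand \<open>dem I i\<close> and weight \<open>wt I i\<close>.\<close>

record ('v, 'e) anf =
  graph :: "('v, 'e) pre_digraph"
  cap :: "'e \<Rightarrow> real"
  ncom :: nat
  src :: "nat \<Rightarrow> 'v"
  tgt :: "nat \<Rightarrow> 'v"
  dem :: "nat \<Rightarrow> real"
  wt :: "nat \<Rightarrow> real"

abbreviation edges :: "('v, 'e) anf \<Rightarrow> 'e set" where
  "edges I \<equiv> arcs (graph I)"

abbreviation commodities :: "('v, 'e) anf \<Rightarrow> nat set" where
  "commodities I \<equiv> {1..ncom I}"

definition num_edges :: "('v, 'e) anf \<Rightarrow> nat" where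
  "num_edges I = card (edges I)"

definition anf_instance :: "('v, 'e) anf \<Rightarrow> bool" where
  "anf_instance I \<longleftrightarrow>
     fin_digraph (graph I) \<and>
     (\<forall>e\<in>edges I. cap I e > 0) \<and>
     (\<forall>i\<in>commodities I.
        src I i \<in> verts (graph I) \<and> tgt I i \<in> verts (graph I) \<and> src I i \<noteq> tgt I i \<and>
        dem I i > 0 \<and> wt I i > 0)"

definition net_outflow :: "('v, 'e) pre_digraph \<Rightarrow> ('e \<Rightarrow> real) \<Rightarrow> 'v \<Rightarrow> real" where
  "net_outflow G x v = (\<Sum>e\<in>out_arcs G v. x e) - (\<Sum>e\<in>in_arcs G v. x e)"

definition is_flow ::
    "('v, 'e) pre_digraph \<Rightarrow> 'v \<Rightarrow> 'v \<Rightarrow> real \<Rightarrow> ('e \<Rightarrow> real) \<Rightarrow> bool" where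
  "is_flow G s t r x \<longleftrightarrow>
     (\<forall>e\<in>arcs G. x e \<ge> 0) \<and>
     net_outflow G x s = r \<and>
     (\<forall>v\<in>verts G - {s, t}. net_outflow G x v = 0)"

definition individually_routable :: "('v, 'e) anf \<Rightarrow> bool" where
  "individually_routable I \<longleftrightarrow>
     (\<forall>i\<in>commodities I. \<exists>x. is_flow (graph I) (src I i) (tgt I i) (dem I i) x \<and>
        (\<forall>e\<in>edges I. x e \<le> cap I e))"

text \<open>A solution is a set \<open>K\<close> of chosen commodities with a flow \<open>x i\<close> for each \<open>i \<in> K\<close>;
  values of \<open>x i\<close> for \<open>i \<notin> K\<close> are irrelevant. The predicate \<open>routes\<close> ignores capacities.\<close>

definition routes :: "('v, 'e) anf \<Rightarrow> nat set \<Rightarrow> (nat \<Rightarrow> 'e \<Rightarrow> real) \<Rightarrow> bool" where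
  "routes I K x \<longleftrightarrow> K \<subseteq> commodities I \<and>
     (\<forall>i\<in>K. is_flow (graph I) (src I i) (tgt I i) (dem I i) (x i))"

definition load :: "nat set \<Rightarrow> (nat \<Rightarrow> 'e \<Rightarrow> real) \<Rightarrow> 'e \<Rightarrow> real" where
  "load K x e = (\<Sum>i\<in>K. x i e)"

definition anf_feasible :: "('v, 'e) anf \<Rightarrow> nat set \<Rightarrow> (nat \<Rightarrow> 'e \<Rightarrow> real) \<Rightarrow> bool" where
  "anf_feasible I K x \<longleftrightarrow> routes I K x \<and> (\<forall>e\<in>edges I. load K x e \<le> cap I e)"

definition throughput :: "('v, 'e) anf \<Rightarrow> nat set \<Rightarrow> real" where
  "throughput I K = (\<Sum>i\<in>K. wt I i)"

text \<open>The maximum ranges over a finite nonempty set: \<open>K\<close> is a subset of \<open>{1..ncom I}\<close>, and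
  \<open>K = {}\<close> is feasible.\<close>

definition anf_opt :: "('v, 'e) anf \<Rightarrow> real" where
  "anf_opt I = Max (throughput I ` {K. \<exists>x. anf_feasible I K x})"

definition anf_approx ::
    "('v, 'e) anf \<Rightarrow> real \<Rightarrow> real \<Rightarrow> nat set \<Rightarrow> (nat \<Rightarrow> 'e \<Rightarrow> real) \<Rightarrow> bool" where
  "anf_approx I \<alpha> \<beta> K x \<longleftrightarrow>
     routes I K x \<and>
     throughput I K \<ge> \<alpha> * anf_opt I \<and>
     (\<forall>e\<in>edges I. load K x e \<le> \<beta> * cap I e)"


section \<open>The compact edge-flow LP\<close>

definition lp_feasible ::
    "('v, 'e) anf \<Rightarrow> (nat \<Rightarrow> real) \<Rightarrow> (nat \<Rightarrow> 'e \<Rightarrow> real) \<Rightarrow> bool" where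
  "lp_feasible I f fe \<longleftrightarrow>
     (\<forall>i\<in>commodities I. is_flow (graph I) (src I i) (tgt I i) (f i) (fe i)) \<and>
     (\<forall>e\<in>edges I. (\<Sum>i\<in>commodities I. dem I i * fe i e) \<le> cap I e) \<and>
     (\<forall>i\<in>commodities I. \<forall>e\<in>edges I. dem I i * fe i e \<le> f i * cap I e) \<and>
     (\<forall>i\<in>commodities I. 0 \<le> f i \<and> f i \<le> 1)"

definition lp_value :: "('v, 'e) anf \<Rightarrow> (nat \<Rightarrow> real) \<Rightarrow> real" where
  "lp_value I f = (\<Sum>i\<in>commodities I. wt I i * f i)"

definition lp_optimal ::
    "('v, 'e) anf \<Rightarrow> (nat \<Rightarrow> real) \<Rightarrow> (nat \<Rightarrow> 'e \<Rightarrow> real) \<Rightarrow> bool" where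
  "lp_optimal I f fe \<longleftrightarrow> lp_feasible I f fe \<and>
     (\<forall>g ge. lp_feasible I g ge \<longrightarrow> lp_value I g \<le> lp_value I f)"


section \<open>Randomized rounding\<close>

definition round_step :: "('v, 'e) anf \<Rightarrow> (nat \<Rightarrow> real) \<Rightarrow> (nat \<Rightarrow> real) pmf" where
  "round_step I f = Pi_pmf (commodities I) 0 (\<lambda>i. map_pmf of_bool (bernoulli_pmf (f i)))"

definition rescale ::
    "(nat \<Rightarrow> real) \<Rightarrow> (nat \<Rightarrow> 'e \<Rightarrow> real) \<Rightarrow> (nat \<Rightarrow> real) \<Rightarrow> nat \<Rightarrow> 'e \<Rightarrow> real" where
  "rescale f fe g = (\<lambda>i e. if g i = 0 then 0 else fe i e / f i * g i)"

definition load_factor :: "('v, 'e) anf \<Rightarrow> real \<Rightarrow> real" where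
  "load_factor I b = 3 * b * ln (real (num_edges I)) / ln (ln (real (num_edges I)))"

definition accepted ::
    "('v, 'e) anf \<Rightarrow> real \<Rightarrow> real \<Rightarrow> (nat \<Rightarrow> real) \<Rightarrow>
     (nat \<Rightarrow> real) \<Rightarrow> (nat \<Rightarrow> 'e \<Rightarrow> real) \<Rightarrow> bool" where
  "accepted I \<epsilon> b f g ge \<longleftrightarrow>
     (\<Sum>i\<in>commodities I. wt I i * g i) \<ge> (1 - \<epsilon>) * (\<Sum>i\<in>commodities I. wt I i * f i) \<and>
     (\<forall>e\<in>edges I. (\<Sum>i\<in>commodities I. ge i e * dem I i) \<le> load_factor I b * cap I e)"

text \<open>At most \<open>N\<close> rounds are performed, each with fresh randomness; the result is \<open>None\<close> if none of
  them is accepted. An accepted result \<open>Some (g, ge)\<close> stands for the solution that chooses the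
  commodities with \<open>g i = 1\<close> and sends \<open>ge i e * dem I i\<close> units of commodity \<open>i\<close> along \<open>e\<close>.\<close>

primrec randomized_rounding ::
    "('v, 'e) anf \<Rightarrow> real \<Rightarrow> real \<Rightarrow> (nat \<Rightarrow> real) \<Rightarrow> (nat \<Rightarrow> 'e \<Rightarrow> real) \<Rightarrow> nat \<Rightarrow>
     ((nat \<Rightarrow> real) \<times> (nat \<Rightarrow> 'e \<Rightarrow> real)) option pmf" where
  "randomized_rounding I \<epsilon> b f fe 0 = return_pmf None"
| "randomized_rounding I \<epsilon> b f fe (Suc N) =
     bind_pmf (round_step I f) (\<lambda>g.
       let ge = rescale f fe g in
       if accepted I \<epsilon> b f g ge then return_pmf (Some (g, ge))
       else randomized_rounding I \<epsilon> b f fe N)"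

definition chosen :: "('v, 'e) anf \<Rightarrow> (nat \<Rightarrow> real) \<Rightarrow> nat set" where
  "chosen I g = {i\<in>commodities I. g i = 1}"

definition edge_flows :: "('v, 'e) anf \<Rightarrow> (nat \<Rightarrow> 'e \<Rightarrow> real) \<Rightarrow> nat \<Rightarrow> 'e \<Rightarrow> real" where
  "edge_flows I ge = (\<lambda>i e. ge i e * dem I i)"

definition achieves_approx ::
    "('v, 'e) anf \<Rightarrow> real \<Rightarrow> real \<Rightarrow> ((nat \<Rightarrow> real) \<times> (nat \<Rightarrow> 'e \<Rightarrow> real)) option \<Rightarrow> bool" where
  "achieves_approx I \<alpha> \<beta> r \<longleftrightarrow>
     (\<exists>g ge. r = Some (g, ge) \<and> anf_approx I \<alpha> \<beta> (chosen I g) (edge_flows I ge))"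

text \<open>The number of rounds is \<open>\<Theta>(ln m / \<epsilon>\<^sup>2)\<close>, with constant \<open>C\<close>.\<close>

definition num_rounds :: "('v, 'e) anf \<Rightarrow> real \<Rightarrow> real \<Rightarrow> nat" where
  "num_rounds I C \<epsilon> = nat \<lceil>C * ln (real (num_edges I)) / \<epsilon>\<^sup>2\<rceil>"

end

theory Submission
  imports Defs
begin

text \<open>
  Every commodity can be routed alone, so each weight is at most the LP value \<open>W\<close>, and the
  throughput of a rounded solution has mean \<open>W\<close> and variance at most \<open>W\<^sup>2\<close>. Cantelli's one-sided
  inequality, unlike Chebyshev's, then gives throughput at least \<open>(1 - \<epsilon>) W\<close> with probability at
  least \<open>\<epsilon>\<^sup>2 / (1 + \<epsilon>\<^sup>2) \<ge> \<epsilon>\<^sup>2 / 2\<close>. The constraints \<open>d\<^sub>i f\<^sub>i\<^sub>e \<le> f\<^sub>i c(e)\<close> bound the contribution of a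
  single commodity to the load of \<open>e\<close> by \<open>c(e)\<close>, so a Chernoff bound makes some edge overloaded with
  probability at most \<open>m \<cdot> m\<^sup>-\<^sup>4 \<le> \<epsilon>\<^sup>2 / 9\<close>, using \<open>\<epsilon> \<ge> 1 / m\<close> and \<open>m \<ge> 9\<close>. Each round thus succeeds with
  probability at least \<open>\<epsilon>\<^sup>2 / 4\<close>, and \<open>4 ln m / \<epsilon>\<^sup>2\<close> rounds all fail with probability at most \<open>1 / m\<close>.
\<close>

section \<open>Weighted sums of independent Bernoulli variables\<close>

text \<open>The rounding distribution freed from the ANF data; \<open>round_step I f\<close> is the
  case \<open>A = commodities I\<close>, \<open>p = f\<close>.\<close>

abbreviation bernoulli_vector :: "'a set \<Rightarrow> ('a \<Rightarrow> real) \<Rightarrow> ('a \<Rightarrow> real) pmf" where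
  "bernoulli_vector A p \<equiv> Pi_pmf A 0 (\<lambda>i. map_pmf of_bool (bernoulli_pmf (p i)))"

lemma finite_set_bernoulli_vector:
  assumes "finite A"
  shows "finite (set_pmf (bernoulli_vector A p))"
  using assms by (subst set_Pi_pmf) auto

lemma bernoulli_vector_01:
  assumes "finite A" "g \<in> set_pmf (bernoulli_vector A p)"
  shows "g i = 0 \<or> g i = 1"
  using assms by (cases "i \<in> A") (fastforce simp: set_Pi_pmf PiE_dflt_def)+

text \<open>Ensures that a chosen commodity has \<open>f i \<noteq> 0\<close>, so that the division
  by \<open>f i\<close> in \<open>rescale\<close> is a genuine one.\<close>

lemma bernoulli_vector_eq_0:
  assumes "finite A" "g \<in> set_pmf (bernoulli_vector A p)" "p i = 0"
  shows "g i = 0"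
proof (cases "i \<in> A")
  case True
  then have "g i \<in> of_bool ` set_pmf (bernoulli_pmf (p i))"
    using assms(1,2) by (auto simp: set_Pi_pmf PiE_dflt_def)
  then show ?thesis
    using assms(3) by (auto simp: set_pmf_iff)
qed (use assms in \<open>auto simp: set_Pi_pmf PiE_dflt_def\<close>)

section \<open>Lower tail: variance and Cantelli's inequality\<close>

lemma expectation_bernoulli_vector_insert:
  assumes "finite A" "x \<notin> A" "0 \<le> p x" "p x \<le> 1"
  shows "measure_pmf.expectation (bernoulli_vector (insert x A) p) h =
    p x * measure_pmf.expectation (bernoulli_vector A p) (\<lambda>g. h (g(x := 1))) +
    (1 - p x) * measure_pmf.expectation (bernoulli_vector A p) (\<lambda>g. h (g(x := 0)))"
    (is "_ = ?rhs")
proof -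
  have "bernoulli_vector (insert x A) p =
      bernoulli_pmf (p x) \<bind> (\<lambda>y. map_pmf (\<lambda>g. g(x := of_bool y)) (bernoulli_vector A p))"
    using assms(1,2) by (simp add: Pi_pmf_insert' bind_map_pmf map_pmf_def bind_assoc_pmf bind_return_pmf)
  also have "measure_pmf.expectation \<dots> h = ?rhs"
    using assms finite_set_bernoulli_vector[OF assms(1)]
    by (subst pmf_expectation_bind[where A = UNIV]) (auto simp: UNIV_bool)
  finally show ?thesis .
qed

text \<open>Centring makes the cross term with \<open>u\<close> vanish. The free shift
  \<open>u\<close> serves the induction, where each new coordinate moves it, and Cantelli's
  inequality, where it is optimised.\<close>

lemma second_moment_bernoulli_vector:
  assumes "finite A" "\<And>i. i \<in> A \<Longrightarrow> 0 \<le> p i \<and> p i \<le> 1"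
  shows "measure_pmf.expectation (bernoulli_vector A p)
      (\<lambda>g. ((\<Sum>i\<in>A. a i * g i) - (\<Sum>i\<in>A. a i * p i) + u)\<^sup>2) =
    (\<Sum>i\<in>A. (a i)\<^sup>2 * p i * (1 - p i)) + u\<^sup>2"
  using assms
proof (induction A arbitrary: u rule: finite_induct)
  case empty
  then show ?case by simp
next
  case (insert x A)
  let ?E = "\<lambda>u. measure_pmf.expectation (bernoulli_vector A p)
      (\<lambda>g. ((\<Sum>i\<in>A. a i * g i) - (\<Sum>i\<in>A. a i * p i) + u)\<^sup>2)"
  let ?V = "\<Sum>i\<in>A. (a i)\<^sup>2 * p i * (1 - p i)"
  have upd: "(\<Sum>i\<in>A. a i * (g(x := y)) i) = (\<Sum>i\<in>A. a i * g i)" for g y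
    using insert.hyps(2) by (intro sum.cong) auto
  have E: "?E v = ?V + v\<^sup>2" for v
    using insert.IH insert.prems by simp
  have "measure_pmf.expectation (bernoulli_vector (insert x A) p)
      (\<lambda>g. ((\<Sum>i\<in>insert x A. a i * g i) - (\<Sum>i\<in>insert x A. a i * p i) + u)\<^sup>2) =
    p x * ?E (a x - a x * p x + u) + (1 - p x) * ?E (u - a x * p x)"
    using insert.hyps insert.prems
    by (subst expectation_bernoulli_vector_insert)
      (simp_all add: upd sum.insert_if algebra_simps del: fun_upd_apply, simp add: algebra_simps)
  \<comment> \<open>The squares of the shifts \<open>u + a x * (1 - p x)\<close> and
    \<open>u - a x * p x\<close>, averaged with weights \<open>p x\<close> and
    \<open>1 - p x\<close>, give \<open>u^2\<close> plus the variance of the new term.\<close>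
  also have "\<dots> = (\<Sum>i\<in>insert x A. (a i)\<^sup>2 * p i * (1 - p i)) + u\<^sup>2"
    unfolding E using insert.hyps by (simp add: algebra_simps power2_eq_square)
  finally show ?case .
qed

text \<open>Markov's inequality for a shifted squared deviation: a shift by \<open>- t\<close>
  yields the bound \<open>(V + t^2) / (l + t)^2\<close>, which \<open>t = V / l\<close>
  minimises.\<close>

lemma cantelli_bernoulli_vector:
  fixes A :: "'a set" and a p :: "'a \<Rightarrow> real"
  defines "\<mu> \<equiv> \<Sum>i\<in>A. a i * p i"
    and "V \<equiv> \<Sum>i\<in>A. (a i)\<^sup>2 * p i * (1 - p i)"
  assumes fin: "finite A" and p: "\<And>i. i \<in> A \<Longrightarrow> 0 \<le> p i \<and> p i \<le> 1" and l: "0 < l"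
  shows "measure_pmf.prob (bernoulli_vector A p) {g. (\<Sum>i\<in>A. a i * g i) \<le> \<mu> - l}
    \<le> V / (V + l\<^sup>2)"
proof -
  let ?M = "bernoulli_vector A p"
  let ?X = "\<lambda>g. (\<Sum>i\<in>A. a i * g i) - \<mu> + (- V / l)"
  have v: "0 \<le> V"
    unfolding V_def using p by (intro sum_nonneg) simp
  have pos: "0 < l + V / l"
    using l v by (simp add: add_pos_nonneg)
  have "measure_pmf.prob ?M {g. (\<Sum>i\<in>A. a i * g i) \<le> \<mu> - l}
      \<le> measure_pmf.prob ?M {g \<in> space ?M. (l + V / l)\<^sup>2 \<le> (?X g)\<^sup>2}"
  proof (rule measure_pmf.finite_measure_mono)
    show "{g. (\<Sum>i\<in>A. a i * g i) \<le> \<mu> - l} \<subseteq> {g \<in> space ?M. (l + V / l)\<^sup>2 \<le> (?X g)\<^sup>2}"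
    proof (clarsimp)
      fix g assume "(\<Sum>i\<in>A. a i * g i) \<le> \<mu> - l"
      then have "l + V / l \<le> - ?X g" by simp
      then have "(l + V / l)\<^sup>2 \<le> (- ?X g)\<^sup>2"
        using pos by (intro power_mono) auto
      then show "(l + V / l)\<^sup>2 \<le> ((\<Sum>i\<in>A. a i * g i) - \<mu> - V / l)\<^sup>2"
        by (simp add: power2_commute)
    qed
  qed simp
  also have "\<dots> \<le> measure_pmf.expectation ?M (\<lambda>g. (?X g)\<^sup>2) / (l + V / l)\<^sup>2"
    using pos finite_set_bernoulli_vector[OF fin]
    by (intro integral_Markov_inequality_measure) (auto intro!: integrable_measure_pmf_finite)
  also have "measure_pmf.expectation ?M (\<lambda>g. (?X g)\<^sup>2) = V + (- V / l)\<^sup>2"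
    unfolding \<mu>_def V_def by (rule second_moment_bernoulli_vector[OF fin p])
  also have "(V + (- V / l)\<^sup>2) / (l + V / l)\<^sup>2 = V / (V + l\<^sup>2)"
  proof -
    have "V + l\<^sup>2 > 0" using v l by (simp add: add_nonneg_pos)
    moreover have "V + (- V / l)\<^sup>2 = V * (V + l\<^sup>2) / l\<^sup>2"
      using l by (simp add: field_simps power2_eq_square)
    moreover have "(l + V / l)\<^sup>2 = (V + l\<^sup>2)\<^sup>2 / l\<^sup>2"
      using l by (simp add: field_simps power2_eq_square)
    ultimately show ?thesis
      using l by (simp add: power2_eq_square)
  qed
  finally show ?thesis .
qed

section \<open>Upper tail: a Chernoff bound\<close>

text \<open>By convexity, \<open>exp\<close> lies below its chord between \<open>0\<close> and
  \<open>ln L\<close>.\<close>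

lemma exp_ln_mult_le:
  fixes L y :: real
  assumes "1 \<le> L" "0 \<le> y" "y \<le> 1"
  shows "exp (ln L * y) \<le> 1 + y * (L - 1)"
  using convex_onD[OF exp_convex, of y 0 "ln L"] assms by (simp add: algebra_simps)

text \<open>Markov's inequality for the exponential moment with parameter \<open>ln L / c\<close>,
  the optimal choice when the mean equals \<open>c\<close>.\<close>

lemma chernoff_bernoulli_vector:
  assumes fin: "finite A" and p: "\<And>i. i \<in> A \<Longrightarrow> 0 \<le> p i \<and> p i \<le> 1"
    and a: "\<And>i. i \<in> A \<Longrightarrow> 0 \<le> a i \<and> a i \<le> c"
    and c: "0 < c" and mean: "(\<Sum>i\<in>A. a i * p i) \<le> c" and L: "1 \<le> L"
  shows "measure_pmf.prob (bernoulli_vector A p) {g. L * c \<le> (\<Sum>i\<in>A. a i * g i)}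
    \<le> exp (L - 1 - L * ln L)"
proof -
  let ?M = "bernoulli_vector A p"
  let ?Z = "\<lambda>g. \<Prod>i\<in>A. exp (ln L * (a i / c) * g i)"
  have Z: "?Z g = exp (ln L * ((\<Sum>i\<in>A. a i * g i) / c))" for g
    using fin by (simp add: exp_sum sum_distrib_left sum_divide_distrib mult_ac flip: exp_sum)
  have "measure_pmf.prob ?M {g. L * c \<le> (\<Sum>i\<in>A. a i * g i)}
      \<le> measure_pmf.prob ?M {g \<in> space ?M. exp (L * ln L) \<le> ?Z g}"
  proof (rule measure_pmf.finite_measure_mono)
    show "{g. L * c \<le> (\<Sum>i\<in>A. a i * g i)} \<subseteq> {g \<in> space ?M. exp (L * ln L) \<le> ?Z g}"
    proof clarsimp
      fix g assume "L * c \<le> (\<Sum>i\<in>A. a i * g i)"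
      then have "L \<le> (\<Sum>i\<in>A. a i * g i) / c"
        using c by (simp add: field_simps)
      then have "ln L * L \<le> ln L * ((\<Sum>i\<in>A. a i * g i) / c)"
        using L by (intro mult_left_mono) auto
      then show "exp (L * ln L) \<le> (\<Prod>i\<in>A. exp (ln L * a i * g i / c))"
        using Z[of g] by (simp add: mult.commute)
    qed
  qed simp
  also have "\<dots> \<le> measure_pmf.expectation ?M ?Z / exp (L * ln L)"
    using finite_set_bernoulli_vector[OF fin]
    by (intro integral_Markov_inequality_measure) (auto intro!: integrable_measure_pmf_finite prod_nonneg)
  also have "measure_pmf.expectation ?M ?Z =
      (\<Prod>i\<in>A. measure_pmf.expectation (map_pmf of_bool (bernoulli_pmf (p i)))
        (\<lambda>y. exp (ln L * (a i / c) * y)))"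
    by (rule expectation_prod_Pi_pmf[OF fin]) (auto intro!: integrable_measure_pmf_finite)
  also have "\<dots> \<le> (\<Prod>i\<in>A. exp (a i * p i * ((L - 1) / c)))"
  proof (rule prod_mono, intro conjI)
    \<comment> \<open>As \<open>a i / c\<close> lies between 0 and 1, the chord bound makes each
      factor linear in \<open>a i * p i\<close>; then \<open>1 + t \<le> exp t\<close> turns the
      product into an exponential of the mean.\<close>
    fix i assume i: "i \<in> A"
    have "exp (ln L * (a i / c)) \<le> 1 + a i / c * (L - 1)"
      using a[OF i] c L by (intro exp_ln_mult_le) auto
    then have "exp (ln L * (a i / c)) * p i + (1 - p i) \<le> (1 + a i / c * (L - 1)) * p i + (1 - p i)"
      using p[OF i] by (intro add_right_mono mult_right_mono) auto
    also have "\<dots> = 1 + a i * p i * ((L - 1) / c)"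
      by (simp add: algebra_simps diff_divide_distrib)
    also have "\<dots> \<le> exp (a i * p i * ((L - 1) / c))"
      by simp
    finally show "measure_pmf.expectation (map_pmf of_bool (bernoulli_pmf (p i)))
        (\<lambda>y. exp (ln L * (a i / c) * y)) \<le> exp (a i * p i * ((L - 1) / c))"
      using p[OF i] by simp
  qed simp
  also have "\<dots> = exp ((\<Sum>i\<in>A. a i * p i) * ((L - 1) / c))"
    using fin by (simp only: exp_sum sum_distrib_right)
  \<comment> \<open>Because \<open>L - 1 \<ge> 0\<close>, an upper bound on the mean
    suffices.\<close>
  also have "\<dots> \<le> exp (c * ((L - 1) / c))"
    using c L by (intro iffD2[OF exp_le_cancel_iff] mult_right_mono mean) auto
  finally show ?thesis
    using c by (simp add: exp_diff divide_right_mono)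
qed


section \<open>Numerical estimates\<close>

text \<open>With \<open>y = ln (ln m)\<close> we have \<open>ln L = ln 5.55 + y - ln y\<close>. Bounding \<open>ln y\<close> by the tangent at
  \<open>3 * 1.85 = 5.55\<close> cancels \<open>ln 5.55\<close>, so no numerical value of a logarithm is needed.\<close>

lemma chernoff_exponent_bound:
  fixes m :: real
  assumes "9 \<le> m"
  defines "L \<equiv> 3 * 1.85 * ln m / ln (ln m)"
  shows "1 \<le> L" "4 * ln m \<le> L * ln L - L"
proof -
  define x where "x = ln m"
  define y where "y = ln x"
  \<comment> \<open>This makes \<open>ln m > 1\<close>, hence the denominator
    \<open>ln (ln m)\<close> positive.\<close>
  have "exp 1 < m"
    using assms exp_le by linarith
  then have x: "1 < x"
    unfolding x_def using assms by (metis ln_exp ln_less_cancel_iff exp_gt_zero less_trans)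
  then have y: "0 < y" and yx: "y \<le> x"
    unfolding y_def using ln_le_minus_one[of x] by auto
  have Lxy: "L = 5.55 * x / y"
    unfolding L_def x_def y_def by simp
  show "1 \<le> L"
    unfolding Lxy using y yx by (simp add: field_simps)
  have "ln L = ln 5.55 + y - ln y"
    unfolding Lxy y_def using x y by (simp add: ln_mult ln_div y_def)
  moreover have "ln y - ln 5.55 \<le> (y - 5.55) / 5.55"
    using y by (intro ln_diff_le) auto
  \<comment> \<open>The tangent gives \<open>ln L - 1 \<ge> (4.55 / 5.55) * y\<close>. The exponent
    4 thus needs \<open>3 * b - 1 \<ge> 4\<close>, which \<open>b = 1.85\<close> satisfies with some
    slack.\<close>
  ultimately have "4 / 5.55 * y \<le> ln L - 1"
    using y by (simp add: field_simps)
  then have "L * (4 / 5.55 * y) \<le> L * (ln L - 1)"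
    using \<open>1 \<le> L\<close> by (intro mult_left_mono) auto
  moreover have "L * (4 / 5.55 * y) = 4 * x"
    unfolding Lxy using y by simp
  ultimately show "4 * ln m \<le> L * ln L - L"
    by (simp add: x_def algebra_simps)
qed


section \<open>The linear program\<close>

lemma is_flow_scale:
  assumes "is_flow G s t r x" "0 \<le> k"
  shows "is_flow G s t (k * r) (\<lambda>e. k * x e)"
  using assms unfolding is_flow_def net_outflow_def
  by (simp flip: sum_distrib_left right_diff_distrib)

lemma is_flow_zero: "is_flow G s t 0 (\<lambda>e. 0)"
  unfolding is_flow_def net_outflow_def by simp

text \<open>The LP is a relaxation of ANF: dividing each chosen flow by its demand gives an integral
  LP solution.\<close>

lemma lp_feasible_of_anf_feasible:
  assumes inst: "anf_instance I" and feas: "anf_feasible I K x"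
  shows "lp_feasible I (\<lambda>i. of_bool (i \<in> K)) (\<lambda>i e. if i \<in> K then x i e / dem I i else 0)"
proof -
  have K: "K \<subseteq> commodities I" "finite K"
    and flow: "\<And>i. i \<in> K \<Longrightarrow> is_flow (graph I) (src I i) (tgt I i) (dem I i) (x i)"
    and ld: "\<And>e. e \<in> edges I \<Longrightarrow> (\<Sum>i\<in>K. x i e) \<le> cap I e"
    using feas finite_subset unfolding anf_feasible_def routes_def load_def by blast+
  have nonneg: "\<And>i e. i \<in> K \<Longrightarrow> e \<in> edges I \<Longrightarrow> 0 \<le> x i e"
    using flow unfolding is_flow_def by blast
  have dem: "\<And>i. i \<in> commodities I \<Longrightarrow> dem I i > 0"
    and cap: "\<And>e. e \<in> edges I \<Longrightarrow> cap I e > 0"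
    using inst unfolding anf_instance_def by auto
  let ?fe = "\<lambda>i e. if i \<in> K then x i e / dem I i else 0"
  have mult: "dem I i * ?fe i e = (if i \<in> K then x i e else 0)" if "i \<in> commodities I" for i e
    using dem[OF that] by simp
  have "is_flow (graph I) (src I i) (tgt I i) (of_bool (i \<in> K)) (?fe i)"
    if "i \<in> commodities I" for i
  proof (cases "i \<in> K")
    case True
    then show ?thesis
      using is_flow_scale[OF flow[OF True], of "1 / dem I i"] dem[OF that] by simp
  qed (simp add: is_flow_zero)
  moreover have "(\<Sum>i\<in>commodities I. dem I i * ?fe i e) \<le> cap I e" if "e \<in> edges I" for e
  proof -
    have "(\<Sum>i\<in>commodities I. dem I i * ?fe i e) = (\<Sum>i\<in>K. x i e)"
    proof -
      have "(\<Sum>i\<in>commodities I. dem I i * ?fe i e) = (\<Sum>i\<in>commodities I. if i \<in> K then x i e else 0)"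
        by (intro sum.cong refl mult)
      also have "\<dots> = (\<Sum>i\<in>K. x i e)"
        using K(1) by (simp add: Int_absorb1 flip: sum.inter_restrict)
      finally show ?thesis .
    qed
    then show ?thesis
      using ld[OF that] by simp
  qed
  \<comment> \<open>The per-commodity constraint cuts off no integral solution: flows are
    nonnegative, so a single one is at most the total load.\<close>
  moreover have "dem I i * ?fe i e \<le> of_bool (i \<in> K) * cap I e"
    if "i \<in> commodities I" "e \<in> edges I" for i e
  proof (cases "i \<in> K")
    case True
    then have "x i e \<le> (\<Sum>i\<in>K. x i e)"
      using K that(2) nonneg by (intro member_le_sum) auto
    then show ?thesis
      using ld[OF that(2)] mult[OF that(1)] True by simp
  qed simp
  ultimately show ?thesis
    unfolding lp_feasible_def by simp
qed

lemma throughput_le_lp_value: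
  assumes inst: "anf_instance I" and opt: "lp_optimal I f fe" and feas: "anf_feasible I K x"
  shows "throughput I K \<le> lp_value I f"
proof -
  have K: "K \<subseteq> commodities I"
    using feas unfolding anf_feasible_def routes_def by blast
  have "throughput I K = lp_value I (\<lambda>i. of_bool (i \<in> K))"
    using K unfolding throughput_def lp_value_def
    by (simp add: of_bool_def if_distrib Int_absorb1 cong: if_cong flip: sum.inter_restrict)
  also have "\<dots> \<le> lp_value I f"
    using opt lp_feasible_of_anf_feasible[OF inst feas] unfolding lp_optimal_def by blast
  finally show ?thesis .
qed

lemma anf_opt_le_lp_value:
  assumes "anf_instance I" "lp_optimal I f fe"
  shows "anf_opt I \<le> lp_value I f"
proof -
  let ?S = "{K. \<exists>x. anf_feasible I K x}"
  have "?S \<subseteq> Pow (commodities I)"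
    unfolding anf_feasible_def routes_def by blast
  then have "finite ?S"
    using finite_subset by blast
  \<comment> \<open>The empty choice makes the set under \<open>Max\<close> nonempty.\<close>
  moreover have "anf_feasible I {} x" for x
    using assms(1) unfolding anf_feasible_def routes_def load_def anf_instance_def
    by (auto intro: less_imp_le)
  ultimately show ?thesis
    unfolding anf_opt_def using throughput_le_lp_value[OF assms]
    by (subst Max_le_iff) auto
qed

text \<open>Here the standing assumption enters: routing \<open>i\<close> alone is a feasible
  solution of throughput \<open>wt I i\<close>.\<close>

lemma weight_le_lp_value:
  assumes "anf_instance I" "individually_routable I" "lp_optimal I f fe" "i \<in> commodities I"
  shows "wt I i \<le> lp_value I f"
proof -
  obtain x where x: "is_flow (graph I) (src I i) (tgt I i) (dem I i) x"
    "\<forall>e\<in>edges I. x e \<le> cap I e"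
    using assms(2,4) unfolding individually_routable_def by blast
  then have "anf_feasible I {i} (\<lambda>_. x)"
    using assms(4) unfolding anf_feasible_def routes_def load_def by simp
  from throughput_le_lp_value[OF assms(1,3) this] show ?thesis
    by (simp add: throughput_def)
qed


section \<open>One round\<close>

text \<open>The case distinction is absorbed by the factor \<open>g i\<close>, so loads are linear
  in \<open>g\<close>, as the Chernoff bound requires.\<close>

lemma rescale_eq: "rescale f fe g i e = fe i e / f i * g i"
  unfolding rescale_def by simp

text \<open>The acceptance test compares with the LP value, which dominates \<open>anf_opt\<close>;
  scaling the LP flow of a chosen commodity by \<open>dem I i / f i\<close> routes its full
  demand.\<close>

lemma accepted_imp_anf_approx:
  assumes inst: "anf_instance I" and opt: "lp_optimal I f fe" and eps: "\<epsilon> < 1"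
    and g: "g \<in> set_pmf (round_step I f)" and acc: "accepted I \<epsilon> b f g (rescale f fe g)"
  shows "anf_approx I (1 - \<epsilon>) (load_factor I b) (chosen I g) (edge_flows I (rescale f fe g))"
proof -
  have g01: "g i = 0 \<or> g i = 1" for i
    using g unfolding round_step_def by (rule bernoulli_vector_01[rotated]) simp
  have restrict: "(\<Sum>i\<in>chosen I g. h i) = (\<Sum>i\<in>commodities I. h i * g i)" for h :: "nat \<Rightarrow> real"
  proof -
    have "(\<Sum>i\<in>chosen I g. h i) = (\<Sum>i\<in>commodities I. if g i = 1 then h i else 0)"
      unfolding chosen_def by (rule sum.inter_filter) simp
    also have "\<dots> = (\<Sum>i\<in>commodities I. h i * g i)"
    proof (rule sum.cong)
      show "(if g i = 1 then h i else 0) = h i * g i" for i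
        using g01[of i] by auto
    qed simp
    finally show ?thesis .
  qed
  have "is_flow (graph I) (src I i) (tgt I i) (dem I i) (edge_flows I (rescale f fe g) i)"
    if i: "i \<in> chosen I g" for i
  proof -
    have gi: "g i = 1" and ic: "i \<in> commodities I"
      using i unfolding chosen_def by auto
    then have "f i \<noteq> 0"
      using g bernoulli_vector_eq_0[of "commodities I" g f i] unfolding round_step_def by auto
    moreover have "0 \<le> f i" "is_flow (graph I) (src I i) (tgt I i) (f i) (fe i)"
      using opt ic unfolding lp_optimal_def lp_feasible_def by blast+
    moreover have "0 \<le> dem I i"
      using inst ic unfolding anf_instance_def by (auto intro: less_imp_le)
    ultimately show ?thesis
      using is_flow_scale[of "graph I" "src I i" "tgt I i" "f i" "fe i" "dem I i / f i"] gi
      unfolding edge_flows_def by (simp add: rescale_eq mult.commute)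
  qed
  then have "routes I (chosen I g) (edge_flows I (rescale f fe g))"
    unfolding routes_def chosen_def by auto
  moreover have "(1 - \<epsilon>) * anf_opt I \<le> throughput I (chosen I g)"
  proof -
    have "(1 - \<epsilon>) * anf_opt I \<le> (1 - \<epsilon>) * lp_value I f"
      using eps anf_opt_le_lp_value[OF inst opt] by (intro mult_left_mono) auto
    then show ?thesis
      using acc unfolding accepted_def throughput_def lp_value_def restrict by linarith
  qed
  moreover have "load (chosen I g) (edge_flows I (rescale f fe g)) e \<le> load_factor I b * cap I e"
    if "e \<in> edges I" for e
  proof -
    have "load (chosen I g) (edge_flows I (rescale f fe g)) e =
        (\<Sum>i\<in>commodities I. rescale f fe g i e * dem I i)"
      unfolding load_def edge_flows_def restrict rescale_eq
    proof (rule sum.cong)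
      \<comment> \<open>Restricting the sum to chosen commodities adds a second factor
        \<open>g i\<close>, which is idempotent for values 0 and 1.\<close>
      show "fe i e / f i * g i * dem I i * g i = fe i e / f i * g i * dem I i" for i
        using g01[of i] by auto
    qed simp
    then show ?thesis
      using acc that unfolding accepted_def by simp
  qed
  ultimately show ?thesis
    unfolding anf_approx_def by blast
qed

text \<open>Since each weight is at most the LP value \<open>W\<close>, the variance is at most
  \<open>W\<close> times the mean, that is \<open>W^2\<close>; Cantelli's inequality applies with
  deviation \<open>\<epsilon> * W\<close>.\<close>

lemma prob_low_throughput:
  assumes inst: "anf_instance I" and rtb: "individually_routable I" and opt: "lp_optimal I f fe"
    and eps: "0 < \<epsilon>"
  shows "measure_pmf.prob (round_step I f)
      {g. (\<Sum>i\<in>commodities I. wt I i * g i) < (1 - \<epsilon>) * lp_value I f} \<le> 1 / (1 + \<epsilon>\<^sup>2)"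
\<comment> \<open>Without commodities \<open>W = 0\<close>, so the deviation would not be positive;
  the event is then empty.\<close>
proof (cases "commodities I = {}")
  case True
  then show ?thesis by (simp add: lp_value_def)
next
  case False
  let ?W = "lp_value I f" and ?V = "\<Sum>i\<in>commodities I. (wt I i)\<^sup>2 * f i * (1 - f i)"
  have f: "\<And>i. i \<in> commodities I \<Longrightarrow> 0 \<le> f i \<and> f i \<le> 1"
    using opt unfolding lp_optimal_def lp_feasible_def by blast
  have w: "\<And>i. i \<in> commodities I \<Longrightarrow> 0 < wt I i"
    using inst unfolding anf_instance_def by blast
  note wW = weight_le_lp_value[OF inst rtb opt]
  have W: "0 < ?W"
    using False w wW by (meson ex_in_conv less_le_trans)
  have V0: "0 \<le> ?V"
    using f by (intro sum_nonneg) auto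
  have "?V \<le> (\<Sum>i\<in>commodities I. ?W * (wt I i * f i))"
  proof (rule sum_mono)
    fix i assume i: "i \<in> commodities I"
    have "(wt I i)\<^sup>2 * f i * (1 - f i) \<le> (wt I i)\<^sup>2 * f i * 1"
      using f[OF i] by (intro mult_left_mono) auto
    also have "\<dots> = wt I i * (wt I i * f i)"
      by (simp add: power2_eq_square)
    also have "\<dots> \<le> ?W * (wt I i * f i)"
      using f[OF i] w[OF i] wW[OF i] by (intro mult_right_mono) auto
    finally show "(wt I i)\<^sup>2 * f i * (1 - f i) \<le> ?W * (wt I i * f i)" .
  qed
  also have "\<dots> = ?W\<^sup>2"
    by (simp add: power2_eq_square lp_value_def flip: sum_distrib_left)
  finally have V: "?V \<le> ?W\<^sup>2" .
  have "measure_pmf.prob (round_step I f)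
      {g. (\<Sum>i\<in>commodities I. wt I i * g i) < (1 - \<epsilon>) * ?W}
    \<le> measure_pmf.prob (round_step I f)
      {g. (\<Sum>i\<in>commodities I. wt I i * g i) \<le> (\<Sum>i\<in>commodities I. wt I i * f i) - \<epsilon> * ?W}"
    by (intro measure_pmf.finite_measure_mono) (auto simp: algebra_simps lp_value_def)
  also have "\<dots> \<le> ?V / (?V + (\<epsilon> * ?W)\<^sup>2)"
    unfolding round_step_def using f eps W by (intro cantelli_bernoulli_vector) auto
  \<comment> \<open>The Cantelli bound increases with the variance, so \<open>W^2\<close> may
    replace it.\<close>
  also have "\<dots> \<le> 1 / (1 + \<epsilon>\<^sup>2)"
  proof -
    have "0 < ?V + (\<epsilon> * ?W)\<^sup>2"
      using V0 eps W by (intro add_nonneg_pos) auto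
    moreover have "\<epsilon>\<^sup>2 * ?V \<le> \<epsilon>\<^sup>2 * ?W\<^sup>2"
      using V by (intro mult_left_mono) auto
    moreover have "0 < 1 + \<epsilon>\<^sup>2"
      by (simp add: add_pos_nonneg)
    ultimately show ?thesis
      by (simp add: divide_le_eq le_divide_eq power_mult_distrib) (simp add: algebra_simps)
  qed
  finally show ?thesis .
qed

text \<open>The load of \<open>e\<close> is a weighted Bernoulli sum with coefficients
  \<open>?a i\<close>. The per-commodity LP constraint caps each coefficient by
  \<open>cap I e\<close>, the joint one caps the mean.\<close>

lemma prob_overload:
  assumes inst: "anf_instance I" and opt: "lp_optimal I f fe" and e: "e \<in> edges I" and L: "1 \<le> L"
  shows "measure_pmf.prob (round_step I f)
      {g. L * cap I e < (\<Sum>i\<in>commodities I. rescale f fe g i e * dem I i)} \<le> exp (L - 1 - L * ln L)"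
proof -
  let ?a = "\<lambda>i. fe i e / f i * dem I i"
  have c: "0 < cap I e" and d: "\<And>i. i \<in> commodities I \<Longrightarrow> 0 < dem I i"
    using inst e unfolding anf_instance_def by blast+
  have f: "\<And>i. i \<in> commodities I \<Longrightarrow> 0 \<le> f i \<and> f i \<le> 1"
    and fe: "\<And>i. i \<in> commodities I \<Longrightarrow> 0 \<le> fe i e"
    and ld: "(\<Sum>i\<in>commodities I. dem I i * fe i e) \<le> cap I e"
    and ind: "\<And>i. i \<in> commodities I \<Longrightarrow> dem I i * fe i e \<le> f i * cap I e"
    using opt e unfolding lp_optimal_def lp_feasible_def is_flow_def by blast+
  have a: "0 \<le> ?a i \<and> ?a i \<le> cap I e" if i: "i \<in> commodities I" for i
  proof (cases "f i = 0")
    case False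
    then have "0 < f i" using f[OF i] by simp
    then show ?thesis
      using ind[OF i] fe[OF i] d[OF i] by (simp add: divide_le_eq mult.commute)
  qed (use c in simp)
  \<comment> \<open>Only an inequality: for \<open>f i = 0\<close> the quotient, and so the left
    side, is 0.\<close>
  have "?a i * f i \<le> dem I i * fe i e" if i: "i \<in> commodities I" for i
    using fe[OF i] d[OF i] by (cases "f i = 0") (auto simp: mult.commute)
  then have mean: "(\<Sum>i\<in>commodities I. ?a i * f i) \<le> cap I e"
    using ld by (meson order_trans sum_mono)
  have "measure_pmf.prob (round_step I f)
      {g. L * cap I e < (\<Sum>i\<in>commodities I. rescale f fe g i e * dem I i)}
    \<le> measure_pmf.prob (round_step I f) {g. L * cap I e \<le> (\<Sum>i\<in>commodities I. ?a i * g i)}"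
    by (intro measure_pmf.finite_measure_mono) (auto simp: rescale_eq mult_ac)
  also have "\<dots> \<le> exp (L - 1 - L * ln L)"
    unfolding round_step_def using f a c mean L by (intro chernoff_bernoulli_vector) auto
  finally show ?thesis .
qed

lemma prob_not_accepted:
  assumes inst: "anf_instance I" and rtb: "individually_routable I" and opt: "lp_optimal I f fe"
    and m: "num_edges I \<ge> 9" and eps: "1 / real (num_edges I) \<le> \<epsilon>" "\<epsilon> < 1"
  shows "measure_pmf.prob (round_step I f) {g. \<not> accepted I \<epsilon> 1.85 f g (rescale f fe g)}
    \<le> 1 - \<epsilon>\<^sup>2 / 4"
proof -
  let ?P = "measure_pmf.prob (round_step I f)"
  define n where "n = real (num_edges I)"
  define L where "L = load_factor I 1.85"
  let ?T = "{g. (\<Sum>i\<in>commodities I. wt I i * g i) < (1 - \<epsilon>) * lp_value I f}"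
  let ?O = "\<lambda>e. {g. L * cap I e < (\<Sum>i\<in>commodities I. rescale f fe g i e * dem I i)}"
  have n: "9 \<le> n"
    using m unfolding n_def by simp
  have e0: "0 < \<epsilon>"
    using eps(1) n unfolding n_def by (smt (verit) divide_pos_pos)
  have fin: "finite (edges I)"
    using inst unfolding anf_instance_def by (simp add: fin_digraph.finite_arcs)
  have L: "1 \<le> L" "4 * ln n \<le> L * ln L - L"
    using chernoff_exponent_bound[OF n] unfolding L_def load_factor_def n_def by simp_all
  have "{g. \<not> accepted I \<epsilon> 1.85 f g (rescale f fe g)} \<subseteq> ?T \<union> (\<Union>e\<in>edges I. ?O e)"
    unfolding accepted_def lp_value_def L_def by (auto simp: not_le)
  then have "?P {g. \<not> accepted I \<epsilon> 1.85 f g (rescale f fe g)} \<le> ?P (?T \<union> (\<Union>e\<in>edges I. ?O e))"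
    by (intro measure_pmf.finite_measure_mono) auto
  also have "\<dots> \<le> ?P ?T + ?P (\<Union>e\<in>edges I. ?O e)"
    by (intro measure_Un_le) auto
  also have "?P ?T \<le> 1 / (1 + \<epsilon>\<^sup>2)"
    by (rule prob_low_throughput[OF inst rtb opt e0])
  also have "?P (\<Union>e\<in>edges I. ?O e) \<le> (\<Sum>e\<in>edges I. ?P (?O e))"
    using fin by (intro measure_pmf.finite_measure_subadditive_finite) auto
  also have "\<dots> \<le> (\<Sum>e\<in>edges I. exp (- (4 * ln n)))"
  proof (rule sum_mono)
    fix e assume "e \<in> edges I"
    then have "?P (?O e) \<le> exp (L - 1 - L * ln L)"
      using prob_overload[OF inst opt _ L(1)] by blast
    also have "\<dots> \<le> exp (- (4 * ln n))"
      using L(2) by simp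
    finally show "?P (?O e) \<le> exp (- (4 * ln n))" .
  qed
  also have "\<dots> = n * (1 / n ^ 4)"
  proof -
    have "exp (4 * ln n) = n ^ 4"
      using n exp_of_nat_mult[of 4 "ln n"] by simp
    then show ?thesis
      by (simp add: n_def num_edges_def exp_minus inverse_eq_divide)
  qed
  \<comment> \<open>Split so that \<open>n \<ge> 9\<close> bounds the first factor and
    \<open>1 / n \<le> \<epsilon>\<close> the second.\<close>
  also have "\<dots> = 1 / n * (1 / n)\<^sup>2"
    using n by (simp add: field_simps eval_nat_numeral)
  also have "\<dots> \<le> 1 / 9 * \<epsilon>\<^sup>2"
    using n eps(1) by (intro mult_mono power_mono) (auto simp: n_def field_simps)
  also have "1 / (1 + \<epsilon>\<^sup>2) \<le> 1 - \<epsilon>\<^sup>2 / 2"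
  proof -
    have "\<epsilon>\<^sup>2 \<le> 1"
      using e0 eps(2) by (simp add: power_le_one)
    then have "0 \<le> \<epsilon>\<^sup>2 * (1 - \<epsilon>\<^sup>2) / 2"
      by simp
    then have "1 \<le> (1 - \<epsilon>\<^sup>2 / 2) * (1 + \<epsilon>\<^sup>2)"
      by (simp add: algebra_simps)
    then show ?thesis
      by (simp add: divide_le_eq add_pos_nonneg)
  qed
  \<comment> \<open>The constants fit because \<open>1/2 - 1/9 \<ge> 1/4\<close>.\<close>
  finally show ?thesis
    using zero_le_power2[of \<epsilon>] by linarith
qed


section \<open>Repeated rounds\<close>

lemma randomized_rounding_SomeD:
  assumes "Some (g, ge) \<in> set_pmf (randomized_rounding I \<epsilon> b f fe N)"
  shows "g \<in> set_pmf (round_step I f) \<and> ge = rescale f fe g \<and> accepted I \<epsilon> b f g ge"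
  using assms by (induction N) (auto simp: Let_def split: if_splits)

text \<open>Rounds use fresh randomness, and an accepted draw puts no mass on \<open>None\<close>;
  so the failure probabilities multiply.\<close>

lemma pmf_randomized_rounding_None:
  "pmf (randomized_rounding I \<epsilon> b f fe N) None =
    measure_pmf.prob (round_step I f) {g. \<not> accepted I \<epsilon> b f g (rescale f fe g)} ^ N"
    (is "_ = measure_pmf.prob _ ?B ^ N")
proof (induction N)
  case (Suc N)
  have "pmf (randomized_rounding I \<epsilon> b f fe (Suc N)) None =
      measure_pmf.expectation (round_step I f)
        (\<lambda>g. indicator ?B g * pmf (randomized_rounding I \<epsilon> b f fe N) None)"
    unfolding randomized_rounding.simps pmf_bind
    by (intro Bochner_Integration.integral_cong) (auto simp: Let_def indicator_def)
  then show ?case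
    by (simp add: Suc.IH)
qed simp

text \<open>Every outcome in the support other than \<open>None\<close> is a valid approximation, so
  only exhausting all rounds counts as failure.\<close>

lemma prob_achieves_approx:
  assumes "anf_instance I" "lp_optimal I f fe" "\<epsilon> < 1"
  shows "1 - measure_pmf.prob (round_step I f) {g. \<not> accepted I \<epsilon> b f g (rescale f fe g)} ^ N
    \<le> measure_pmf.prob (randomized_rounding I \<epsilon> b f fe N)
        {r. achieves_approx I (1 - \<epsilon>) (load_factor I b) r}"
proof -
  let ?M = "randomized_rounding I \<epsilon> b f fe N"
  let ?S = "{r. achieves_approx I (1 - \<epsilon>) (load_factor I b) r}"
  have "r \<in> ?S" if rM: "r \<in> set_pmf ?M" and rN: "r \<noteq> None" for r
  proof -
    obtain g ge where r: "r = Some (g, ge)"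
      using rN by auto
    have "anf_approx I (1 - \<epsilon>) (load_factor I b) (chosen I g) (edge_flows I ge)"
      using randomized_rounding_SomeD[OF rM[unfolded r]] accepted_imp_anf_approx[OF assms] by metis
    then show ?thesis
      unfolding achieves_approx_def r by simp
  qed
  then have "measure_pmf.prob ?M (- {None}) \<le> measure_pmf.prob ?M ?S"
    by (intro measure_pmf.finite_measure_mono_AE) (auto simp: AE_measure_pmf_iff)
  moreover have "measure_pmf.prob ?M (- {None}) = 1 - pmf ?M None"
    using measure_pmf.prob_compl[of "{None}" ?M] by (simp add: measure_pmf_single Compl_eq_Diff_UNIV)
  ultimately show ?thesis
    by (simp add: pmf_randomized_rounding_None)
qed

theorem corollary5p1:
  shows "\<exists>b::real. b = 1.85 \<and>
    (\<exists>C>0. \<exists>c'>0. \<forall>(I :: ('v, 'e) anf) \<epsilon> f fe.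
       anf_instance I \<longrightarrow> individually_routable I \<longrightarrow> num_edges I \<ge> 9 \<longrightarrow>
       1 / real (num_edges I) \<le> \<epsilon> \<longrightarrow> \<epsilon> < 1 \<longrightarrow>
       lp_optimal I f fe \<longrightarrow>
       b > 1 / real (num_edges I) \<and>
       measure_pmf.prob (randomized_rounding I \<epsilon> b f fe (num_rounds I C \<epsilon>))
         {r. achieves_approx I (1 - \<epsilon>) (load_factor I b) r}
       \<ge> 1 - real (num_edges I) powr (- c'))"
proof (rule exI[of _ "1.85"], rule conjI[OF refl], rule exI[of _ 4], rule conjI[OF zero_less_numeral],
    rule exI[of _ 1], rule conjI[OF zero_less_one], intro allI impI conjI)
  fix I :: "('v, 'e) anf" and \<epsilon> :: real and f fe
  assume inst: "anf_instance I" and rtb: "individually_routable I" and m: "num_edges I \<ge> 9"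
    and eps: "1 / real (num_edges I) \<le> \<epsilon>" "\<epsilon> < 1" and opt: "lp_optimal I f fe"
  define n where "n = real (num_edges I)"
  have n: "9 \<le> n"
    using m unfolding n_def by simp
  then show "1 / real (num_edges I) < 1.85"
    unfolding n_def by (simp add: field_simps)
  let ?N = "num_rounds I 4 \<epsilon>"
  let ?q = "measure_pmf.prob (round_step I f) {g. \<not> accepted I \<epsilon> 1.85 f g (rescale f fe g)}"
  have e0: "0 < \<epsilon>"
    using eps(1) n unfolding n_def by (smt (verit) divide_pos_pos)
  \<comment> \<open>The constant \<open>C = 4\<close> offsets the success probability
    \<open>\<epsilon>^2 / 4\<close> per round, leaving the exponent \<open>- ln n\<close> and hence
    \<open>c' = 1\<close>.\<close>
  have N: "4 * ln n / \<epsilon>\<^sup>2 \<le> real ?N"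
    unfolding num_rounds_def n_def by linarith
  have "?q \<le> exp (- (\<epsilon>\<^sup>2 / 4))"
    using prob_not_accepted[OF inst rtb opt m eps] exp_ge_add_one_self[of "- (\<epsilon>\<^sup>2 / 4)"] by linarith
  then have "?q ^ ?N \<le> exp (- (\<epsilon>\<^sup>2 / 4)) ^ ?N"
    by (intro power_mono) auto
  also have "\<dots> = exp (- (real ?N * (\<epsilon>\<^sup>2 / 4)))"
    by (simp flip: exp_of_nat_mult)
  also have "\<dots> \<le> exp (- ln n)"
    using N e0 by (simp add: field_simps)
  also have "\<dots> = n powr (- 1)"
    using n by (simp add: powr_def)
  finally show "1 - real (num_edges I) powr (- 1) \<le>
      measure_pmf.prob (randomized_rounding I \<epsilon> 1.85 f fe ?N)
        {r. achieves_approx I (1 - \<epsilon>) (load_factor I 1.85) r}"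
    using prob_achieves_approx[OF inst opt eps(2), where b = "1.85" and N = ?N] unfolding n_def by linarith
qed

end
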